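(* Let $\Omega\subsetneq\mathbb R$ be the union of $n\in\mathbb N$ non-empty bounded open intervals, each with measure at most $\ell\in(0,\infty)$ and at distance at least $\delta\in(0,\infty)$ from the others. For $s\in(0,1)$ and $p\in[1,\infty)$ such that $sp\le1$, it holds that $$[u]^p_{W^{s,p}(\Omega^\delta)}\ge\frac{2}{sp}\left(1-\left(\frac{\ell}{\ell+\delta}\right)^{sp}\right)\int_\Omega\frac{|u|^p}{d_\Omega^{sp}}\,dx$$ for all $u\in C^\infty_0(\Omega)$.
   Context: $\Omega^\delta=\{x\in\mathbb R:\operatorname{dist}(x,\Omega)<\delta\}$ is the open $\delta$-neighborhood of $\Omega$. For an open set $A\subseteq\mathbb R$, $s\in(0,1)$, $p\in[1,\infty)$ and measurable $u$, $$[u]^p_{W^{s,p}(A)}=\int_A\int_A\frac{|u(x)-u(y)|^p}{|x-y|^{1+sp}}\,dx\,dy.$$ $d_\Omega(x)=\inf_{y\in\partial\Omega}|x-y|$ for $x\in\Omega$, and $C^\infty_0(\Omega)$ is the set of smooth real functions on $\mathbb R$ with compact support contained in $\Omega$. *)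

theory Defs
  imports "HOL-Analysis.Analysis"
begin

text \<open>The distance to the empty set counts as infinite here, whereas \<open>infdist x {} = 0\<close>.\<close>

definition open_nbhd :: "real set \<Rightarrow> real \<Rightarrow> real set" where
  "open_nbhd A \<delta> = {x. A \<noteq> {} \<and> infdist x A < \<delta>}"

text \<open>The \<open>p\<close>-th power of the Gagliardo seminorm, with values in \<open>[0, \<infinity>]\<close>. On the diagonal
  the integrand is \<open>0 / 0 = 0\<close>; the diagonal is a null set.\<close>

definition gagliardo_seminorm_pow :: "real \<Rightarrow> real \<Rightarrow> real set \<Rightarrow> (real \<Rightarrow> real) \<Rightarrow> ennreal" where
  "gagliardo_seminorm_pow s p A u =
     (\<integral>\<^sup>+x\<in>A. (\<integral>\<^sup>+y\<in>A.
        ennreal (\<bar>u x - u y\<bar> powr p / \<bar>x - y\<bar> powr (1 + s * p)) \<partial>lborel) \<partial>lborel)"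

definition boundary_dist :: "real set \<Rightarrow> real \<Rightarrow> real" where
  "boundary_dist \<Omega> x = infdist x (frontier \<Omega>)"

definition smooth_compact_support :: "real set \<Rightarrow> (real \<Rightarrow> real) set" where
  "smooth_compact_support \<Omega> =
     {u. (\<forall>k x. (deriv ^^ k) u differentiable (at x)) \<and>
         compact (closure {x. u x \<noteq> 0}) \<and> closure {x. u x \<noteq> 0} \<subseteq> \<Omega>}"

end

theory Submission
  imports Defs
begin

text \<open>
  Write \<open>\<alpha> = s p\<close>. Every point \<open>x\<close> of \<open>\<Omega>\<close> lies in one of the intervals; let \<open>z\<close> be its nearer
  endpoint and \<open>d\<close> the distance from \<open>x\<close> to \<open>z\<close>. The other intervals are at distance at least \<open>\<delta>\<close>,
  so the interval of length \<open>\<delta>\<close> that starts at \<open>z\<close> and points away from \<open>x\<close> lies in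
  \<open>\<Omega>\<^sup>\<delta> - \<Omega>\<close> (lemma \<open>exists_exterior_interval\<close>). There \<open>u\<close> vanishes, so the inner integral over
  \<open>\<Omega>\<^sup>\<delta> - \<Omega>\<close> is at least \<open>|u(x)|\<^sup>p\<close> times the integral of \<open>t powr (-1 - \<alpha>)\<close> over
  \<open>[d, d + \<delta>)\<close>, which equals
  \<open>|u(x)|\<^sup>p / (\<alpha> d\<^sup>\<alpha>) * (1 - (d / (d + \<delta>))\<^sup>\<alpha>)\<close>. Here \<open>d\<close> is at most the distance to the boundary,
  and \<open>d \<le> l\<close> bounds the last factor below by the constant of the theorem
  (lemma \<open>nn_integral_power_kernel_ge\<close>).

  The integrand of the seminorm is symmetric, and \<open>\<Omega> \<times> (\<Omega>\<^sup>\<delta> - \<Omega>)\<close> and its mirror image are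
  disjoint parts of \<open>\<Omega>\<^sup>\<delta> \<times> \<Omega>\<^sup>\<delta>\<close>. This gives the factor \<open>2\<close> (lemma
  \<open>nn_integral_symmetric_square_ge\<close>). The interactions inside \<open>\<Omega> \<times> \<Omega>\<close>, and those across
  the farther endpoint, are simply dropped.
\<close>

lemma nn_integral_power_kernel:
  fixes d \<delta> \<alpha> :: real
  assumes "0 < d" "0 \<le> \<delta>" "0 < \<alpha>"
  shows "(\<integral>\<^sup>+t. ennreal (t powr (-1 - \<alpha>)) * indicator {d..d + \<delta>} t \<partial>lborel)
    = ennreal ((d powr - \<alpha> - (d + \<delta>) powr - \<alpha>) / \<alpha>)"
proof -
  have "(\<integral>\<^sup>+t. ennreal (t powr (-1 - \<alpha>)) * indicator {d..d + \<delta>} t \<partial>lborel)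
      = ennreal (- ((d + \<delta>) powr - \<alpha>) / \<alpha> - (- (d powr - \<alpha>) / \<alpha>))"
  proof (rule nn_integral_FTC_Icc)
    fix t assume "t \<in> {d..d + \<delta>}"
    then show "((\<lambda>t. - (t powr - \<alpha>) / \<alpha>) has_real_derivative t powr (-1 - \<alpha>)) (at t)"
      using assms by (auto intro!: derivative_eq_intros simp: minus_diff_commute)
  qed (use assms in auto)
  then show ?thesis
    by (simp add: diff_divide_distrib)
qed

text \<open>
  The quotient \<open>d / (d + \<delta>)\<close> increases with \<open>d\<close>, so the factor \<open>1 - (d / (d + \<delta>)) powr \<alpha>\<close> of the exact
  integral is smallest at the largest admissible distance \<open>l\<close>. The distance \<open>r\<close> in the denominator
  may exceed \<open>d\<close>, since this only weakens the bound. The interval of integration is half-open because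
  the open \<open>\<delta>\<close>-neighbourhood can miss the point at distance exactly \<open>\<delta>\<close> from an endpoint.
\<close>

lemma nn_integral_power_kernel_ge:
  fixes d r l \<delta> \<alpha> :: real
  assumes "0 < d" "d \<le> l" "d \<le> r" "0 < \<delta>" "0 < \<alpha>"
  shows "ennreal ((1 - (l / (l + \<delta>)) powr \<alpha>) / \<alpha> / r powr \<alpha>)
    \<le> (\<integral>\<^sup>+t. ennreal (t powr (-1 - \<alpha>)) * indicator {d..<d + \<delta>} t \<partial>lborel)"
proof -
  have "d / (d + \<delta>) \<le> l / (l + \<delta>)"
    using assms by (simp add: field_simps)
  then have mono: "(d / (d + \<delta>)) powr \<alpha> \<le> (l / (l + \<delta>)) powr \<alpha>"
    using assms by (intro powr_mono2) auto
  have nonneg: "(l / (l + \<delta>)) powr \<alpha> \<le> 1"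
    using assms by (intro powr_le1) auto
  have "(1 - (l / (l + \<delta>)) powr \<alpha>) / \<alpha> / r powr \<alpha> \<le> (1 - (d / (d + \<delta>)) powr \<alpha>) / \<alpha> / d powr \<alpha>"
    using assms mono nonneg by (intro frac_le divide_right_mono powr_mono2) auto
  also have "\<dots> = (d powr - \<alpha> - (d + \<delta>) powr - \<alpha>) / \<alpha>"
    using assms by (simp add: powr_divide powr_minus field_simps)
  finally have "ennreal ((1 - (l / (l + \<delta>)) powr \<alpha>) / \<alpha> / r powr \<alpha>)
      \<le> (\<integral>\<^sup>+t. ennreal (t powr (-1 - \<alpha>)) * indicator {d..d + \<delta>} t \<partial>lborel)"
    using assms by (simp add: nn_integral_power_kernel ennreal_leI)
  also have "\<dots> = (\<integral>\<^sup>+t. ennreal (t powr (-1 - \<alpha>)) * indicator {d..<d + \<delta>} t \<partial>lborel)"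
  proof (rule nn_integral_cong_AE)
    show "AE t in lborel. ennreal (t powr (-1 - \<alpha>)) * indicator {d..d + \<delta>} t
        = ennreal (t powr (-1 - \<alpha>)) * indicator {d..<d + \<delta>} t"
      using AE_lborel_singleton[of "d + \<delta>"] by eventually_elim (auto split: split_indicator)
  qed
  finally show ?thesis .
qed

text \<open>
  Parametrising the exterior interval by \<open>x + \<sigma> * t\<close> with \<open>\<sigma> = 1\<close> or \<open>\<sigma> = - 1\<close> lets one computation
  serve both the left and the right endpoint.
\<close>

lemma nn_integral_kernel_ge_of_exterior_interval:
  fixes x \<sigma> d r l \<delta> \<alpha> :: real
  assumes "0 < d" "d \<le> l" "d \<le> r" "0 < \<delta>" "0 < \<alpha>"
    and \<sigma>: "\<sigma> = 1 \<or> \<sigma> = - 1"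
    and C: "C \<in> sets borel" "\<And>t. d \<le> t \<Longrightarrow> t < d + \<delta> \<Longrightarrow> x + \<sigma> * t \<in> C"
  shows "ennreal ((1 - (l / (l + \<delta>)) powr \<alpha>) / \<alpha> / r powr \<alpha>)
    \<le> (\<integral>\<^sup>+y\<in>C. ennreal (1 / \<bar>x - y\<bar> powr (1 + \<alpha>)) \<partial>lborel)"
proof -
  have "ennreal ((1 - (l / (l + \<delta>)) powr \<alpha>) / \<alpha> / r powr \<alpha>)
      \<le> (\<integral>\<^sup>+t. ennreal (t powr (-1 - \<alpha>)) * indicator {d..<d + \<delta>} t \<partial>lborel)"
    using assms by (intro nn_integral_power_kernel_ge) auto
  also have "\<dots> \<le> (\<integral>\<^sup>+t. ennreal (1 / \<bar>x - (x + \<sigma> * t)\<bar> powr (1 + \<alpha>)) * indicator C (x + \<sigma> * t) \<partial>lborel)"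
  proof (rule nn_integral_mono)
    fix t :: real
    show "ennreal (t powr (-1 - \<alpha>)) * indicator {d..<d + \<delta>} t
        \<le> ennreal (1 / \<bar>x - (x + \<sigma> * t)\<bar> powr (1 + \<alpha>)) * indicator C (x + \<sigma> * t)"
    proof (cases "t \<in> {d..<d + \<delta>}")
      case True
      have "t powr (-1 - \<alpha>) = t powr - (1 + \<alpha>)"
        by simp
      also have "\<dots> = 1 / \<bar>x - (x + \<sigma> * t)\<bar> powr (1 + \<alpha>)"
        using True \<sigma> assms(1) unfolding powr_minus by (auto simp: abs_mult field_simps)
      finally show ?thesis
        using True C(2)[of t] by simp
    qed auto
  qed
  also have "\<dots> = (\<integral>\<^sup>+y\<in>C. ennreal (1 / \<bar>x - y\<bar> powr (1 + \<alpha>)) \<partial>lborel)"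
    using C(1) \<sigma>
    by (subst nn_integral_real_affine[of "\<lambda>y. ennreal (1 / \<bar>x - y\<bar> powr (1 + \<alpha>)) * indicator C y" \<sigma> x])
      auto
  finally show ?thesis .
qed

text \<open>
  Splitting \<open>A = B \<union> (A - B)\<close>, the squares \<open>B \<times> B\<close> and \<open>(A - B) \<times> (A - B)\<close> are discarded and the two
  remaining rectangles contribute equally, by symmetry and Tonelli's theorem.
\<close>

lemma nn_integral_symmetric_square_ge:
  fixes f :: "real \<Rightarrow> real \<Rightarrow> ennreal"
  assumes f: "case_prod f \<in> borel_measurable (lborel \<Otimes>\<^sub>M lborel)"
    and sym: "\<And>x y. f x y = f y x"
    and A: "A \<in> sets borel" and B: "B \<in> sets borel" "B \<subseteq> A"
  shows "2 * (\<integral>\<^sup>+x\<in>B. (\<integral>\<^sup>+y\<in>A - B. f x y \<partial>lborel) \<partial>lborel)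
    \<le> (\<integral>\<^sup>+x\<in>A. (\<integral>\<^sup>+y\<in>A. f x y \<partial>lborel) \<partial>lborel)"
proof -
  define C where "C = A - B"
  have [measurable]: "A \<in> sets borel" "B \<in> sets borel" "C \<in> sets borel"
    using A B by (auto simp: C_def)
  have [measurable (raw)]: "(\<lambda>z. f (g z) (h z)) \<in> borel_measurable M"
    if "g \<in> borel_measurable M" "h \<in> borel_measurable M" for g h and M :: "'c measure"
    using measurable_compose[OF measurable_Pair[of g M lborel h lborel] f] that by simp
  have BC: "(\<integral>\<^sup>+x\<in>B. (\<integral>\<^sup>+y\<in>C. f x y \<partial>lborel) \<partial>lborel)
      = (\<integral>\<^sup>+x. (\<integral>\<^sup>+y. f x y * indicator C y * indicator B x \<partial>lborel) \<partial>lborel)"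
    by (simp add: nn_integral_multc)
  have CB: "(\<integral>\<^sup>+x\<in>C. (\<integral>\<^sup>+y\<in>B. f x y \<partial>lborel) \<partial>lborel)
      = (\<integral>\<^sup>+x. (\<integral>\<^sup>+y. f x y * indicator B y * indicator C x \<partial>lborel) \<partial>lborel)"
    by (simp add: nn_integral_multc)
  have "(\<integral>\<^sup>+x\<in>C. (\<integral>\<^sup>+y\<in>B. f x y \<partial>lborel) \<partial>lborel)
      = (\<integral>\<^sup>+y. (\<integral>\<^sup>+x. f x y * indicator B y * indicator C x \<partial>lborel) \<partial>lborel)"
    unfolding CB by (rule lborel_pair.Fubini') (simp add: case_prod_beta')
  also have "\<dots> = (\<integral>\<^sup>+x\<in>B. (\<integral>\<^sup>+y\<in>C. f x y \<partial>lborel) \<partial>lborel)"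
    unfolding BC by (subst sym) (simp add: ac_simps)
  finally have swap: "(\<integral>\<^sup>+x\<in>C. (\<integral>\<^sup>+y\<in>B. f x y \<partial>lborel) \<partial>lborel)
      = (\<integral>\<^sup>+x\<in>B. (\<integral>\<^sup>+y\<in>C. f x y \<partial>lborel) \<partial>lborel)" .
  have "2 * (\<integral>\<^sup>+x\<in>B. (\<integral>\<^sup>+y\<in>C. f x y \<partial>lborel) \<partial>lborel)
      = (\<integral>\<^sup>+x\<in>B. (\<integral>\<^sup>+y\<in>C. f x y \<partial>lborel) \<partial>lborel) + (\<integral>\<^sup>+x\<in>C. (\<integral>\<^sup>+y\<in>B. f x y \<partial>lborel) \<partial>lborel)"
    unfolding swap by (simp add: mult_2)
  also have "\<dots> = (\<integral>\<^sup>+x. (\<integral>\<^sup>+y\<in>C. f x y \<partial>lborel) * indicator B x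
      + (\<integral>\<^sup>+y\<in>B. f x y \<partial>lborel) * indicator C x \<partial>lborel)"
    by (rule nn_integral_add[symmetric]) auto
  also have "\<dots> \<le> (\<integral>\<^sup>+x\<in>A. (\<integral>\<^sup>+y\<in>A. f x y \<partial>lborel) \<partial>lborel)"
  proof (rule nn_integral_mono)
    fix x
    have "(\<integral>\<^sup>+y\<in>D. f x y \<partial>lborel) \<le> (\<integral>\<^sup>+y\<in>A. f x y \<partial>lborel)" if "D \<subseteq> A" for D
      using that by (intro nn_integral_mono) (auto split: split_indicator)
    from this[of B] this[of C]
    show "(\<integral>\<^sup>+y\<in>C. f x y \<partial>lborel) * indicator B x + (\<integral>\<^sup>+y\<in>B. f x y \<partial>lborel) * indicator C x
        \<le> (\<integral>\<^sup>+y\<in>A. f x y \<partial>lborel) * indicator A x"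
      using B(2) by (auto simp: C_def split: split_indicator)
  qed
  finally show ?thesis
    by (simp add: C_def)
qed

lemma bounded_open_interval_eq:
  fixes J :: "real set"
  assumes "J \<noteq> {}" "is_interval J" "open J" "bounded J"
  obtains a b where "a < b" "J = {a<..<b}"
proof -
  have "convex J"
    using assms(2) by (simp add: is_interval_convex)
  then have "connected (closure J)" "compact (closure J)"
    using assms(4) by (auto simp: convex_connected connected_imp_connected_closure compact_closure)
  then obtain a b where ab: "closure J = {a..b}"
    using connected_compact_interval_1 by blast
  have "J = interior (closure J)"
    using \<open>convex J\<close> assms(3) by (simp add: convex_interior_closure interior_open)
  also have "\<dots> = {a<..<b}"
    unfolding ab by simp
  finally have "J = {a<..<b}" .
  with assms(1) show ?thesis
    by (intro that[of a b]) auto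
qed

text \<open>
  A point of the exterior interval of length \<open>\<delta>\<close> at an endpoint \<open>z\<close> of \<open>I i\<close> is closer than \<open>\<delta>\<close> to \<open>z\<close>.
  This puts it into the open neighbourhood, because \<open>z\<close> is in the closure of \<open>\<Omega>\<close>, and keeps it
  out of every other \<open>I j\<close>, because \<open>z\<close> is in the closure of \<open>I i\<close>.
\<close>

lemma near_closure_in_exterior:
  fixes I :: "'i \<Rightarrow> real set"
  assumes sep: "\<And>j. j \<in> K \<Longrightarrow> j \<noteq> i \<Longrightarrow> \<delta> \<le> setdist (I i) (I j)"
    and "i \<in> K" "z \<in> closure (I i)" "dist y z < \<delta>" "y \<notin> I i"
  shows "y \<in> open_nbhd (\<Union>j\<in>K. I j) \<delta> - (\<Union>j\<in>K. I j)"
proof -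
  let ?\<Omega> = "\<Union>j\<in>K. I j"
  have "I i \<subseteq> ?\<Omega>"
    using assms(2) by auto
  then have z: "z \<in> closure ?\<Omega>"
    using assms(3) closure_mono by blast
  then have ne: "?\<Omega> \<noteq> {}"
    by (metis closure_empty empty_iff)
  have "infdist z ?\<Omega> = 0"
    using z ne in_closure_iff_infdist_zero by blast
  then have "infdist y ?\<Omega> < \<delta>"
    using infdist_triangle[of y ?\<Omega> z] assms(4) by simp
  moreover have "y \<notin> I j" if "j \<in> K" for j
  proof
    assume y: "y \<in> I j"
    then have "\<delta> \<le> setdist (closure (I i)) (I j)"
      using sep[OF that] assms(5) by auto
    also have "\<dots> \<le> dist z y"
      using assms(3) y by (rule setdist_le_dist)
    finally show False
      using assms(4) by (simp add: dist_commute)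
  qed
  ultimately show ?thesis
    using ne by (auto simp: open_nbhd_def)
qed

text \<open>
  Take \<open>d\<close> to be the distance from \<open>x\<close> to the nearer endpoint of its interval and \<open>\<sigma>\<close> the direction
  of that endpoint. Then \<open>d\<close> is at most the distance to the boundary of \<open>\<Omega>\<close>, because no boundary point
  lies in the open set \<open>I i\<close>. The boundary is nonempty since \<open>\<Omega>\<close> is neither empty nor the whole
  line, so \<open>infdist\<close> does not take its default value \<open>0\<close>.
\<close>

lemma exists_exterior_interval:
  fixes I :: "'i \<Rightarrow> real set"
  assumes \<Omega>: "\<Omega> = (\<Union>j\<in>K. I j)" "\<Omega> \<noteq> UNIV"
    and I: "i \<in> K" "is_interval (I i)" "open (I i)" "bounded (I i)" "measure lborel (I i) \<le> l"
    and sep: "\<And>j. j \<in> K \<Longrightarrow> j \<noteq> i \<Longrightarrow> \<delta> \<le> setdist (I i) (I j)"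
    and x: "x \<in> I i"
  obtains \<sigma> d where "\<sigma> = 1 \<or> \<sigma> = - 1" "0 < d" "d \<le> l" "d \<le> boundary_dist \<Omega> x"
    "\<And>t. d \<le> t \<Longrightarrow> t < d + \<delta> \<Longrightarrow> x + \<sigma> * t \<in> open_nbhd \<Omega> \<delta> - \<Omega>"
proof -
  obtain a b where ab: "a < b" "I i = {a<..<b}"
    using bounded_open_interval_eq[of "I i"] I x by blast
  have xab: "a < x" "x < b" and len: "b - a \<le> l"
    using x I(5) ab by auto
  have cl: "a \<in> closure (I i)" "b \<in> closure (I i)"
    using ab by auto
  define d where "d = min (x - a) (b - x)"
  have "I i \<subseteq> interior \<Omega>"
    using I(1,3) \<Omega>(1) by (intro interior_maximal) auto
  then have out: "z \<notin> I i" if "z \<in> frontier \<Omega>" for z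
    using that by (auto simp: frontier_def)
  have "x \<in> \<Omega>"
    using x I(1) \<Omega>(1) by auto
  then have "frontier \<Omega> \<noteq> {}"
    using \<Omega>(2) frontier_eq_empty[of \<Omega>] by auto
  moreover have "d \<le> dist x z" if "z \<in> frontier \<Omega>" for z
    using out[OF that] ab(2) xab by (auto simp: d_def dist_real_def)
  ultimately have "d \<le> boundary_dist \<Omega> x"
    unfolding boundary_dist_def infdist_def by (auto intro: cINF_greatest)
  moreover have "0 < d" "d \<le> l"
    using xab len by (auto simp: d_def)
  moreover have "\<exists>\<sigma>. (\<sigma> = 1 \<or> \<sigma> = - 1) \<and> (\<forall>t. d \<le> t \<longrightarrow> t < d + \<delta> \<longrightarrow> x + \<sigma> * t \<in> open_nbhd \<Omega> \<delta> - \<Omega>)"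
  proof (cases "x - a \<le> b - x")
    case True
    have "x + - 1 * t \<in> open_nbhd \<Omega> \<delta> - \<Omega>" if "d \<le> t" "t < d + \<delta>" for t
      unfolding \<Omega>(1) using sep I(1) cl(1)
      by (rule near_closure_in_exterior) (use True that ab in \<open>auto simp: d_def dist_real_def\<close>)
    then show ?thesis by blast
  next
    case False
    have "x + 1 * t \<in> open_nbhd \<Omega> \<delta> - \<Omega>" if "d \<le> t" "t < d + \<delta>" for t
      unfolding \<Omega>(1) using sep I(1) cl(2)
      by (rule near_closure_in_exterior) (use False that ab in \<open>auto simp: d_def dist_real_def\<close>)
    then show ?thesis by blast
  qed
  ultimately show ?thesis
    using that by blast
qed

lemma sets_open_nbhd: "open_nbhd A \<delta> \<in> sets borel"
proof -
  have "open {x. infdist x A < \<delta>}"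
    by (intro open_Collect_less continuous_intros)
  then show ?thesis
    by (cases "A = {}") (auto simp: open_nbhd_def)
qed

lemma smooth_compact_support_measurable:
  assumes "u \<in> smooth_compact_support \<Omega>"
  shows "u \<in> borel_measurable borel"
proof -
  have "(deriv ^^ 0) u differentiable at x" for x
    using assms unfolding smooth_compact_support_def by blast
  then have "continuous_on UNIV u"
    by (auto intro!: continuous_at_imp_continuous_on differentiable_imp_continuous_within)
  then show ?thesis
    by (rule borel_measurable_continuous_onI)
qed

theorem theorem4p10:
  fixes \<Omega> :: "real set" and I :: "nat \<Rightarrow> real set" and n :: nat
    and l \<delta> s p :: real and u :: "real \<Rightarrow> real"
  assumes "\<Omega> = (\<Union>i<n. I i)"
    and "\<Omega> \<noteq> UNIV"
    and "\<And>i. i < n \<Longrightarrow> I i \<noteq> {} \<and> is_interval (I i) \<and> open (I i) \<and> bounded (I i)"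
    and "\<And>i. i < n \<Longrightarrow> measure lborel (I i) \<le> l"
    and "\<And>i j. i < n \<Longrightarrow> j < n \<Longrightarrow> i \<noteq> j \<Longrightarrow> setdist (I i) (I j) \<ge> \<delta>"
    and "0 < l" and "0 < \<delta>"
    and "0 < s" and "s < 1" and "1 \<le> p" and "s * p \<le> 1"
    and "u \<in> smooth_compact_support \<Omega>"
  shows "gagliardo_seminorm_pow s p (open_nbhd \<Omega> \<delta>) u
    \<ge> ennreal (2 / (s * p) * (1 - (l / (l + \<delta>)) powr (s * p)))
      * (\<integral>\<^sup>+x\<in>\<Omega>. ennreal (\<bar>u x\<bar> powr p / boundary_dist \<Omega> x powr (s * p)) \<partial>lborel)"
proof -
  define \<alpha> where "\<alpha> = s * p"
  define c where "c = (1 - (l / (l + \<delta>)) powr \<alpha>) / \<alpha>"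
  define A where "A = open_nbhd \<Omega> \<delta>"
  define f where "f x y = ennreal (\<bar>u x - u y\<bar> powr p / \<bar>x - y\<bar> powr (1 + \<alpha>))" for x y
  have \<alpha>: "0 < \<alpha>"
    using assms by (simp add: \<alpha>_def)
  have "(l / (l + \<delta>)) powr \<alpha> \<le> 1"
    using assms \<alpha> by (intro powr_le1) auto
  then have c: "0 \<le> c"
    using \<alpha> by (simp add: c_def)
  have "open \<Omega>"
    using assms(1,3) by auto
  then have \<Omega>[measurable]: "\<Omega> \<in> sets borel"
    by simp
  have A[measurable]: "A \<in> sets borel"
    unfolding A_def by (rule sets_open_nbhd)
  have "\<Omega> \<subseteq> A"
    using assms(7) by (auto simp: A_def open_nbhd_def)
  have u[measurable]: "u \<in> borel_measurable borel"
    using assms(12) by (rule smooth_compact_support_measurable)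
  have u0: "u y = 0" if "y \<notin> \<Omega>" for y
    using assms(12) that closure_subset[of "{x. u x \<noteq> 0}"] by (auto simp: smooth_compact_support_def)
  have [measurable]: "boundary_dist \<Omega> \<in> borel_measurable borel"
    unfolding boundary_dist_def by (intro borel_measurable_continuous_onI continuous_intros)
  have inner: "ennreal c * ennreal (\<bar>u x\<bar> powr p / boundary_dist \<Omega> x powr \<alpha>)
      \<le> (\<integral>\<^sup>+y\<in>A - \<Omega>. f x y \<partial>lborel)" if x: "x \<in> \<Omega>" for x
  proof -
    obtain i where i: "i < n" "x \<in> I i"
      using x assms(1) by auto
    have "i \<in> {..<n}" "is_interval (I i)" "open (I i)" "bounded (I i)" "measure lborel (I i) \<le> l"
      and sep: "\<And>j. j \<in> {..<n} \<Longrightarrow> j \<noteq> i \<Longrightarrow> \<delta> \<le> setdist (I i) (I j)"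
      using i assms(3-5) by auto
    from exists_exterior_interval[OF assms(1,2) this i(2)]
    obtain \<sigma> d where \<sigma>d: "\<sigma> = 1 \<or> \<sigma> = - 1" "0 < d" "d \<le> l" "d \<le> boundary_dist \<Omega> x"
      "\<And>t. d \<le> t \<Longrightarrow> t < d + \<delta> \<Longrightarrow> x + \<sigma> * t \<in> A - \<Omega>"
      unfolding A_def by blast
    have "ennreal c * ennreal (\<bar>u x\<bar> powr p / boundary_dist \<Omega> x powr \<alpha>)
        = ennreal (\<bar>u x\<bar> powr p) * ennreal (c / boundary_dist \<Omega> x powr \<alpha>)"
      using c by (simp add: ennreal_mult[symmetric] mult.commute)
    also have "\<dots> \<le> ennreal (\<bar>u x\<bar> powr p) * (\<integral>\<^sup>+y\<in>A - \<Omega>. ennreal (1 / \<bar>x - y\<bar> powr (1 + \<alpha>)) \<partial>lborel)"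
      unfolding c_def using \<sigma>d assms(7) \<alpha>
      by (intro mult_left_mono nn_integral_kernel_ge_of_exterior_interval[where d = d and \<sigma> = \<sigma>]) auto
    also have "\<dots> = (\<integral>\<^sup>+y. ennreal (\<bar>u x\<bar> powr p)
        * (ennreal (1 / \<bar>x - y\<bar> powr (1 + \<alpha>)) * indicator (A - \<Omega>) y) \<partial>lborel)"
      by (rule nn_integral_cmult[symmetric]) auto
    \<comment> \<open>Outside \<open>\<Omega>\<close> the function vanishes, so the difference \<open>u x - u y\<close> is \<open>u x\<close>.\<close>
    also have "\<dots> = (\<integral>\<^sup>+y\<in>A - \<Omega>. f x y \<partial>lborel)"
      by (intro nn_integral_cong)
        (auto simp: f_def u0 ennreal_mult[symmetric] split: split_indicator)
    finally show ?thesis .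
  qed
  have m: "case_prod f \<in> borel_measurable (lborel \<Otimes>\<^sub>M lborel)"
    unfolding f_def by measurable
  have "ennreal (2 * c) * (\<integral>\<^sup>+x\<in>\<Omega>. ennreal (\<bar>u x\<bar> powr p / boundary_dist \<Omega> x powr \<alpha>) \<partial>lborel)
      = 2 * (ennreal c * (\<integral>\<^sup>+x\<in>\<Omega>. ennreal (\<bar>u x\<bar> powr p / boundary_dist \<Omega> x powr \<alpha>) \<partial>lborel))"
    using c by (simp add: ennreal_mult mult.assoc)
  also have "\<dots> = 2 * (\<integral>\<^sup>+x. ennreal c
      * (ennreal (\<bar>u x\<bar> powr p / boundary_dist \<Omega> x powr \<alpha>) * indicator \<Omega> x) \<partial>lborel)"
    by (subst nn_integral_cmult) auto
  also have "\<dots> \<le> 2 * (\<integral>\<^sup>+x\<in>\<Omega>. (\<integral>\<^sup>+y\<in>A - \<Omega>. f x y \<partial>lborel) \<partial>lborel)"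
    using inner by (intro mult_left_mono nn_integral_mono) (auto split: split_indicator)
  also have "\<dots> \<le> (\<integral>\<^sup>+x\<in>A. (\<integral>\<^sup>+y\<in>A. f x y \<partial>lborel) \<partial>lborel)"
    using m A \<Omega> \<open>\<Omega> \<subseteq> A\<close>
    by (intro nn_integral_symmetric_square_ge) (auto simp: f_def abs_minus_commute)
  also have "\<dots> = gagliardo_seminorm_pow s p (open_nbhd \<Omega> \<delta>) u"
    by (simp add: gagliardo_seminorm_pow_def f_def A_def \<alpha>_def)
  finally show ?thesis
    by (simp add: c_def \<alpha>_def)
qed

end
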